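(* Let $A\in\mathbb{C}^{q\times n}$, let $W\in\mathbb{C}^{n\times q}$ with $W\neq 0$, let $m$ be a positive integer and $k=\max\{\mathrm{Ind}(AW),\mathrm{Ind}(WA)\}$. Then the $W$-weighted $m$-weak group inverse $A^{\mathrm{wg}_m,W}$ of $A$ satisfies: (1) $A^{\mathrm{wg}_m,W}=(A^{D,W})^{\star(m+1)}P_{\mathcal{R}((WA)^k)}WA^{\star m}$; (2) $A^{\mathrm{wg}_m,W}=A^{\star l}W\left(WA^{\star(l+m+1)}W\right)^{\dag}WA^{\star m}$ for every integer $l\ge k$; (3) $A^{\mathrm{wg}_m,W}=\left(WA^{\star(m+1)}WP_{\mathcal{R}((AW)^k)}\right)^{\dag}WA^{\star m}$; (4) $A^{\mathrm{wg}_m,W}=A^{\star(m-1)}W(A^{\star m})^{\mathrm{wg},W}$; (5) $A^{\mathrm{wg}_m,W}=(A^{\mathrm{wg},W})^{\star m}WA^{\star(m-1)}$; (6) $A^{\mathrm{wg}_m,W}=\left((AW)^mA^{\mathrm{cEP},W}WA\right)^{\#,W}WA^{\star(m-1)}$; (7) $A^{\mathrm{wg}_m,W}=A\left((WA)^{\mathrm{wg}_m}\right)^2$.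
   Context: Notation: $\mathcal{R}(B)$ is the range (column space) of $B$ and $B^{\dag}$ its Moore-Penrose inverse. For square $B$, $B^0=I$ and $\mathrm{Ind}(B)$ is the smallest integer $j\ge 0$ with $\mathrm{rank}(B^{j})=\mathrm{rank}(B^{j+1})$. $P_{\mathcal{T}}$ is the orthogonal projector onto the subspace $\mathcal{T}$. $W$-product: for $X,Y\in\mathbb{C}^{q\times n}$, $X\star Y=XWY$, and $X^{\star l}=X\star\cdots\star X$ ($l$ factors) for $l\ge 1$. Convention for exponent zero: $X^{\star 0}W=I_q$ and $WX^{\star 0}=I_n$. Generalized inverses of a matrix $C\in\mathbb{C}^{q\times n}$ with weight $W$, where $k_C=\max\{\mathrm{Ind}(CW),\mathrm{Ind}(WC)\}$ (existence and uniqueness are known in each case; all are $q\times n$ matrices): - $W$-weighted Drazin inverse $C^{D,W}$: the unique $X$ with $(CW)^{k_C}=(CW)^{k_C+1}XW$, $X=XWCWX$, $CWX=XWC$. When $k_C\le 1$ it is called the $W$-weighted group inverse and denoted $C^{\#,W}$. - Weighted core-EP inverse $C^{\mathrm{cEP},W}$: the unique $X$ with $WCWX=P_{\mathcal{R}((WC)^{k_C})}$ and $\mathcal{R}(X)\subseteq\mathcal{R}((CW)^{k_C})$. - $W$-weighted weak group inverse $C^{\mathrm{wg},W}$: the unique $X$ with $CWX^{\star 2}=X$ and $CWX=C^{\mathrm{cEP},W}WC$. - $W$-weighted $m$-weak group inverse: $C^{\mathrm{wg}_m,W}=(C^{\mathrm{cEP},W})^{\star(m+1)}\,W\,C^{\star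 m}$. For a square matrix $B\in\mathbb{C}^{n\times n}$ the unweighted versions are obtained with $W=I_n$: the core-EP inverse $B^{\mathrm{cEP}}$ is the unique $X$ with $BX=P_{\mathcal{R}(B^{j})}$, $\mathcal{R}(X)\subseteq\mathcal{R}(B^{j})$, $j=\mathrm{Ind}(B)$, and the $m$-weak group inverse is $B^{\mathrm{wg}_m}=(B^{\mathrm{cEP}})^{m+1}B^m$. *)

theory Defs
  imports "HOL-Analysis.Analysis"
begin

text \<open>
  A complex \<open>q \<times> n\<close> matrix has type \<open>complex^'n^'q\<close>. Note that \<open>*\<close>, \<open>^\<close> and \<open>1\<close> on this type are
  componentwise; the matrix product is \<open>**\<close>, the identity is \<open>mat 1\<close>, and matrix powers are
  \<open>mpow\<close> below.
\<close>

primrec mpow :: "complex^'n^'n \<Rightarrow> nat \<Rightarrow> complex^'n^'n" where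
  "mpow B 0 = mat 1"
| "mpow B (Suc j) = B ** mpow B j"

definition ctranspose :: "complex^'n^'m \<Rightarrow> complex^'m^'n" where
  "ctranspose B = (\<chi> i j. cnj (B $ j $ i))"

definition mrange :: "complex^'n^'m \<Rightarrow> (complex^'m) set" where
  "mrange B = range (\<lambda>x. B *v x)"

definition Ind :: "complex^'n^'n \<Rightarrow> nat" where
  "Ind B = (LEAST j. rank (mpow B j) = rank (mpow B (Suc j)))"

definition orth_proj :: "(complex^'n) set \<Rightarrow> complex^'n^'n" where
  "orth_proj T = (THE P. P ** P = P \<and> ctranspose P = P \<and> mrange P = T)"

definition moore_penrose :: "complex^'n^'m \<Rightarrow> complex^'m^'n" where
  "moore_penrose B = (THE X. B ** X ** B = B \<and> X ** B ** X = X
     \<and> ctranspose (B ** X) = B ** X \<and> ctranspose (X ** B) = X ** B)"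

definition wprod :: "complex^'q^'n \<Rightarrow> complex^'n^'q \<Rightarrow> complex^'n^'q \<Rightarrow> complex^'n^'q" where
  "wprod W X Y = X ** W ** Y"

text \<open>
  \<open>wpow W X l\<close> is the \<open>l\<close>-fold \<open>W\<close>-product of \<open>X\<close>, meaningful only for \<open>l \<ge> 1\<close>; its value at
  \<open>l = 0\<close> is a dummy. The zeroth power makes sense only next to a factor \<open>W\<close>, and the conventions
  for it are built into \<open>wpow_W\<close> (power times \<open>W\<close>) and \<open>W_wpow\<close> (\<open>W\<close> times power).
\<close>

fun wpow :: "complex^'q^'n \<Rightarrow> complex^'n^'q \<Rightarrow> nat \<Rightarrow> complex^'n^'q" where
  "wpow W X 0 = 0"
| "wpow W X (Suc 0) = X"
| "wpow W X (Suc (Suc l)) = wprod W X (wpow W X (Suc l))"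

definition wpow_W :: "complex^'q^'n \<Rightarrow> complex^'n^'q \<Rightarrow> nat \<Rightarrow> complex^'q^'q" where
  "wpow_W W X l = (if l = 0 then mat 1 else wpow W X l ** W)"

definition W_wpow :: "complex^'q^'n \<Rightarrow> complex^'n^'q \<Rightarrow> nat \<Rightarrow> complex^'n^'n" where
  "W_wpow W X l = (if l = 0 then mat 1 else W ** wpow W X l)"

definition wInd :: "complex^'q^'n \<Rightarrow> complex^'n^'q \<Rightarrow> nat" where
  "wInd W C = max (Ind (C ** W)) (Ind (W ** C))"

definition wDrazin :: "complex^'q^'n \<Rightarrow> complex^'n^'q \<Rightarrow> complex^'n^'q" where
  "wDrazin W C = (THE X.
     mpow (C ** W) (wInd W C) = mpow (C ** W) (wInd W C + 1) ** X ** W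
     \<and> X = X ** W ** C ** W ** X
     \<and> C ** W ** X = X ** W ** C)"

text \<open>
  The weighted group inverse is the weighted Drazin inverse in the case \<open>wInd W C \<le> 1\<close>. A statement
  using it has to assert that condition separately.
\<close>

definition wgroup :: "complex^'q^'n \<Rightarrow> complex^'n^'q \<Rightarrow> complex^'n^'q" where
  "wgroup W C = wDrazin W C"

definition wcoreEP :: "complex^'q^'n \<Rightarrow> complex^'n^'q \<Rightarrow> complex^'n^'q" where
  "wcoreEP W C = (THE X.
     W ** C ** W ** X = orth_proj (mrange (mpow (W ** C) (wInd W C)))
     \<and> mrange X \<subseteq> mrange (mpow (C ** W) (wInd W C)))"

definition wwg :: "complex^'q^'n \<Rightarrow> complex^'n^'q \<Rightarrow> complex^'n^'q" where
  "wwg W C = (THE X. C ** W ** wpow W X 2 = X \<and> C ** W ** X = wcoreEP W C ** W ** C)"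

definition wwgm :: "nat \<Rightarrow> complex^'q^'n \<Rightarrow> complex^'n^'q \<Rightarrow> complex^'n^'q" where
  "wwgm m W C = wpow W (wcoreEP W C) (m + 1) ** W_wpow W C m"

definition coreEP :: "complex^'n^'n \<Rightarrow> complex^'n^'n" where
  "coreEP B = (THE X. B ** X = orth_proj (mrange (mpow B (Ind B)))
     \<and> mrange X \<subseteq> mrange (mpow B (Ind B)))"

definition wgm :: "nat \<Rightarrow> complex^'n^'n \<Rightarrow> complex^'n^'n" where
  "wgm m B = mpow (coreEP B) (m + 1) ** mpow B m"

end

theory Submission
  imports Defs
begin

text \<open>
  Let \<open>k\<close> be the weighted index of \<open>A\<close> and let \<open>P\<close> be the orthogonal projector onto the range of
  \<open>(WA)\<^sup>k\<close>. Beyond the index the ranges of the powers are stable, so \<open>AW\<close> acts invertibly on the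
  range of \<open>(AW)\<^sup>k\<close>, \<open>WA\<close> acts invertibly on the range of \<open>(WA)\<^sup>k\<close>, and \<open>W\<close> carries the first
  range bijectively onto the second. The weighted core-EP inverse \<open>X\<close> of \<open>A\<close> is the inverse of the
  bijection \<open>WAW\<close> between these two ranges, composed with \<open>P\<close>. Hence on the two ranges \<open>XW\<close> inverts
  \<open>AW\<close> and \<open>WX\<close> inverts \<open>WA\<close>, which is the content of a handful of absorption identities:
  \<open>WAWX = P\<close>, \<open>AWXWX = X\<close>, \<open>XP = X\<close>, \<open>PWX = WX\<close>, and \<open>XWAW\<close> is the identity on the range of
  \<open>(AW)\<^sup>k\<close>.

  The weighted \<open>m\<close>-weak group inverse is \<open>X(WX)\<^sup>m(WA)\<^sup>m\<close>. Every other generalized inverse in the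
  theorem is determined by equations with a unique solution, and the identities above
  express the relevant part of it through \<open>X\<close>:
  \<^item> the weighted Drazin inverse \<open>Y\<close> also inverts \<open>WAW\<close> on the relevant range, so \<open>YP = X\<close> and
    \<open>(YW)\<^sup>jX = X(WX)\<^sup>j\<close>;
  \<^item> with \<open>B = W(AW)\<^sup>l\<^sup>+\<^sup>m\<^sup>+\<^sup>1\<close> and \<open>l \<ge> k\<close>, the product of \<open>B\<close> with its Moore-Penrose inverse is \<open>P\<close>, so
    inserting it behind \<open>X(WX)\<^sup>m\<close> changes nothing, and \<open>X(WX)\<^sup>m\<close> then cancels \<open>W(AW)\<^sup>m\<^sup>+\<^sup>1\<close>;
  \<^item> \<open>X(WX)\<^sup>m\<close> is the Moore-Penrose inverse of \<open>W(AW)\<^sup>m\<^sup>+\<^sup>1\<close> composed with the orthogonal projector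
    onto the range of \<open>(AW)\<^sup>k\<close>;
  \<^item> the core-EP inverse of the \<open>W\<close>-power of \<open>A\<close> with exponent \<open>m\<close> is \<open>X(WX)\<^sup>m\<^sup>-\<^sup>1\<close>;
  \<^item> the weighted weak group inverse is \<open>XWXWA\<close>, and its \<open>W\<close>-power with exponent \<open>m\<close> is \<open>X(WX)\<^sup>mWA\<close>;
  \<^item> the weighted group inverse of \<open>(AW)\<^sup>mXWA\<close> is \<open>X(WX)\<^sup>mWA\<close>;
  \<^item> the core-EP inverse of \<open>WA\<close> is \<open>WX\<close>.

  The linear algebra behind this is compressed into factorizations. For \<open>i \<ge> Ind B\<close> and every \<open>j\<close> there
  are \<open>Y\<close> and \<open>Z\<close> with \<open>B\<^sup>i = B\<^sup>jY = ZB\<^sup>j\<close> (\<open>mpow_right_factor\<close>, \<open>mpow_left_factor\<close>); the first gives existence of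
  the inverses, the second their uniqueness, and what follows is algebra with the identities above.
  The factorizations also show that the index in the definitions may be replaced by any larger exponent,
  which is needed because \<open>A\<close> and its \<open>W\<close>-powers can have different indices.
\<close>


section \<open>Matrix powers and weighted powers\<close>

text \<open>
  Products of rectangular matrices are normalized by nesting them to the right. An identity
  for a product is then usable in the middle of a longer one through \<open>mult_reassoc\<close>.
\<close>

lemmas mult_right_nested = matrix_mul_assoc [symmetric]

lemma mult_reassoc:
  "B ** C = D \<Longrightarrow> B ** (C ** E) = D ** E"
  by (metis matrix_mul_assoc)

lemma mpow_add: "mpow B (i + j) = mpow B i ** mpow B j"
  by (induction i) (simp_all add: mult_right_nested)

lemma mpow_Suc_right: "mpow B (Suc j) = mpow B j ** B"
  using mpow_add [of B j 1] by simp

lemma mpow_mpow: "mpow (mpow B m) j = mpow B (m * j)"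
  by (induction j) (simp_all add: mpow_add)

text \<open>
  This law trades powers of \<open>WA\<close> for powers of \<open>AW\<close>; with it every weighted power reduces to an
  ordinary one.
\<close>

lemma mpow_swap: "C ** mpow (D ** C) j = mpow (C ** D) j ** C"
  by (induction j) (simp_all add: matrix_mul_assoc, metis matrix_mul_assoc)

lemma wpow_Suc: "wpow W X (Suc l) = mpow (X ** W) l ** X"
  by (induction l) (simp_all add: wprod_def mult_right_nested)

lemma wpow_W_eq: "wpow_W W X l = mpow (X ** W) l"
  by (cases l) (simp_all add: wpow_W_def wpow_Suc mpow_Suc_right mult_right_nested del: mpow.simps(2))

lemma W_wpow_eq: "W_wpow W X l = mpow (W ** X) l"
proof (cases l)
  case (Suc i)
  then show ?thesis
    using mpow_swap [of W X i]
    by (simp add: W_wpow_def wpow_Suc mpow_Suc_right matrix_mul_assoc del: mpow.simps(2))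
qed (simp add: W_wpow_def)


section \<open>Column ranges and rank\<close>

lemma mult_axis: "B *v axis i a = a *s column i B"
  for B :: "'a::field^'n^'m"
  by (simp add: vec_eq_iff matrix_vector_mult_def axis_def column_def if_distrib mult.commute
      cong: if_cong)

lemma mrange_subset_iff_factor: "mrange B \<subseteq> mrange C \<longleftrightarrow> (\<exists>Y. B = C ** Y)"
proof
  assume sub: "mrange B \<subseteq> mrange C"
  have "\<exists>y. B *v axis i 1 = C *v y" for i
    using sub by (auto simp: mrange_def)
  then obtain y where y: "\<And>i. B *v axis i 1 = C *v y i"
    by metis
  define Y where "Y = transpose (\<chi> i. y i)"
  have "column i B = C *v column i Y" for i
    using y [of i] unfolding mult_axis by (simp add: Y_def column_def transpose_def)
  then have "B = C ** Y"
    by (simp add: vec_eq_iff column_def matrix_matrix_mult_def matrix_vector_mult_def)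
  then show "\<exists>Y. B = C ** Y" ..
next
  assume "\<exists>Y. B = C ** Y"
  then show "mrange B \<subseteq> mrange C"
    by (auto simp: mrange_def simp flip: matrix_vector_mul_assoc)
qed

lemma mrange_eqI: "B = C ** Y \<Longrightarrow> C = B ** Z \<Longrightarrow> mrange B = mrange C"
  using mrange_subset_iff_factor by (metis subset_antisym)

text \<open>
  Since \<open>rank\<close> is the dimension of the row space, a comparison of ranks yields factorizations
  by matrices on the left.
\<close>

lemma span_rows: "vec.span (rows B) = range (\<lambda>x. x v* B)"
  for B :: "'a::field^'n^'m"
proof
  have sub: "vec.subspace (range (\<lambda>x. x v* B))"
    unfolding transpose_matrix_vector [symmetric]
    by (metis vec.subspace_UNIV vec.subspace_image matrix_vector_mul_linear_gen
        vec.linear_subspace_image)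
  have "rows B \<subseteq> range (\<lambda>x. x v* B)"
  proof
    fix r assume "r \<in> rows B"
    then obtain i where "r = row i B"
      by (auto simp: rows_def)
    then have "r = axis i 1 v* B"
      using mult_axis [of "transpose B" i 1] by (simp add: column_transpose)
    then show "r \<in> range (\<lambda>x. x v* B)"
      by blast
  qed
  then show "vec.span (rows B) \<subseteq> range (\<lambda>x. x v* B)"
    by (rule vec.span_minimal [OF _ sub])
  show "range (\<lambda>x. x v* B) \<subseteq> vec.span (rows B)"
    using matrix_vector_mult_in_columnspace_gen [of "transpose B"] by auto
qed

lemma rows_mult_subset_span: "rows (C ** B) \<subseteq> vec.span (rows B)"
  for B :: "'a::field^'n^'m"
proof -
  have "vec.span (rows (C ** B)) \<subseteq> vec.span (rows B)"
    by (auto simp: span_rows simp flip: vector_matrix_mul_assoc)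
  then show ?thesis
    using vec.span_superset by blast
qed

lemma rank_mult_le_right_factor: "rank (C ** B) \<le> rank B"
  for B :: "'a::field^'n^'m"
  unfolding row_rank_def_gen by (rule vec.dim_mono [OF rows_mult_subset_span])

lemma left_factor_of_rank_eq:
  fixes B :: "'a::field^'n^'m"
  assumes "rank (C ** B) = rank B"
  obtains Z where "B = Z ** (C ** B)"
proof -
  have "vec.span (rows (C ** B)) = vec.span (rows B)"
    using vec.subspace_dim_equal
     [of "vec.span (rows (C ** B))" "vec.span (rows B)"]
      assms rows_mult_subset_span [of C B]
    by (simp add: row_rank_def_gen vec.dim_span vec.span_minimal)
  then have "\<exists>z. row i B = z v* (C ** B)" for i
    using vec.span_base [of "row i B" "rows B"] span_rows [of "C ** B"]
    by (auto simp: rows_def)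
  then obtain z where z: "\<And>i. row i B = z i v* (C ** B)"
    by metis
  have "B = (\<chi> i. z i) ** (C ** B)"
    using z by (simp add: vec_eq_iff row_def matrix_matrix_mult_def [of "\<chi> i. z i"]
        vector_matrix_mult_def)
  then show ?thesis
    using that by blast
qed


section \<open>The index\<close>

text \<open>
  The ranks of successive powers do not increase, so they cannot change at every step.
\<close>

lemma rank_mpow_Ind: "rank (mpow B (Ind B)) = rank (mpow B (Suc (Ind B)))"
  unfolding Ind_def
proof (rule LeastI_ex, rule ccontr)
  assume neg: "\<nexists>j. rank (mpow B j) = rank (mpow B (Suc j))"
  have dec: "rank (mpow B (Suc j)) < rank (mpow B j)" for j
    using neg rank_mult_le_right_factor [of B "mpow B j"] by (metis le_neq_implies_less mpow.simps(2))
  have "rank (mpow B j) + j \<le> rank (mpow B 0)" for j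
  proof (induction j)
    case (Suc j)
    then show ?case using dec [of j] by linarith
  qed simp
  from this [of "Suc (rank (mpow B 0))"] show False
    by simp
qed

text \<open>
  Equality of the ranks of two successive powers means equality of their row spaces, hence a
  left factor for one step. Multiplying by powers on the right and iterating reaches
  any exponent.
\<close>

lemma mpow_left_factor:
  assumes "Ind B \<le> i"
  obtains Z where "mpow B i = Z ** mpow B j"
proof -
  obtain Z where Z: "mpow B (Ind B) = Z ** mpow B (Suc (Ind B))"
    using left_factor_of_rank_eq [OF rank_mpow_Ind [of B, unfolded mpow.simps(2), symmetric]]
    unfolding mpow.simps(2) .
  have step: "mpow B i = Z ** mpow B (Suc i)"
    if le: "Ind B \<le> i" for i
  proof -
    obtain d where "i = Ind B + d"
      using le_Suc_ex [OF le] by blast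
    then have "mpow B i = mpow B (Ind B) ** mpow B d"
      "mpow B (Suc i) = mpow B (Suc (Ind B)) ** mpow B d"
      by (simp_all add: mpow_add mult_right_nested)
    then show ?thesis
      using Z by (metis matrix_mul_assoc)
  qed
  have "mpow B i = mpow Z d ** mpow B (i + d)" for d
  proof (induction d)
    case (Suc d)
    have "mpow B (i + d) = Z ** mpow B (i + Suc d)"
      using step [of "i + d"] assms by (metis add_Suc_right trans_le_add1)
    then show ?case
      using Suc.IH mpow_Suc_right [of Z d] by (metis matrix_mul_assoc)
  qed simp
  from this [of j] have "mpow B i = (mpow Z j ** mpow B i) ** mpow B j"
    by (metis matrix_mul_assoc mpow_add)
  then show ?thesis
    using that by blast
qed

text \<open>
  The left factorization makes \<open>B\<^sup>j\<close> injective on the range of \<open>B\<^sup>i\<close>. An injective linear map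
  preserves dimension, so the range of \<open>B\<^sup>j\<^sup>+\<^sup>i\<close>, which lies inside that of \<open>B\<^sup>i\<close>, is all of it.
\<close>

lemma mpow_right_factor:
  assumes "Ind B \<le> i"
  obtains Y where "mpow B i = mpow B j ** Y"
proof -
  \<comment> \<open>Aiming at the exponent \<open>j + i\<close> is what makes \<open>B\<^sup>j\<close> injective on the range of \<open>B\<^sup>i\<close>.\<close>
  obtain Z where Z: "mpow B i = Z ** mpow B (j + i)"
    using mpow_left_factor [OF assms] .
  have Bj: "(*v) (mpow B j) ` mrange (mpow B i) = mrange (mpow B (j + i))"
    by (simp add: mrange_def image_image mpow_add matrix_vector_mul_assoc)
  have sub: "vec.subspace (mrange C)" for C :: "complex^'a^'a"
    unfolding mrange_def by (simp add: vec.linear_subspace_image)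
  have inj: "inj_on ((*v) (mpow B j)) (mrange (mpow B i))"
  proof (rule inj_onI)
    fix x y
    assume "x \<in> mrange (mpow B i)" "y \<in> mrange (mpow B i)"
      and eq: "mpow B j *v x = mpow B j *v y"
    then obtain u v where "x = mpow B i *v u" "y = mpow B i *v v"
      by (auto simp: mrange_def)
    with eq Z show "x = y"
      by (metis matrix_vector_mul_assoc mpow_add)
  qed
  have "vec.span (mrange (mpow B i)) = mrange (mpow B i)"
    using sub by simp
  then have "vec.dim (mrange (mpow B (j + i))) = vec.dim (mrange (mpow B i))"
    using vec.dim_image_eq [OF matrix_vector_mul_linear_gen, of "mpow B j" "mrange (mpow B i)"]
      inj Bj by metis
  moreover have "mrange (mpow B (j + i)) \<subseteq> mrange (mpow B i)"
    unfolding mrange_subset_iff_factor by (metis add.commute mpow_add)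
  ultimately have "mrange (mpow B i) = mrange (mpow B (j + i))"
    using vec.subspace_dim_equal [OF sub sub] by (metis order_refl)
  then obtain Y where "mpow B i = mpow B (j + i) ** Y"
    using mrange_subset_iff_factor by blast
  then have "mpow B i = mpow B j ** (mpow B i ** Y)"
    by (simp add: mpow_add mult_right_nested)
  then show ?thesis
    using that by blast
qed

lemma mrange_mpow_eq:
  assumes "Ind B \<le> i" "Ind B \<le> j"
  shows "mrange (mpow B i) = mrange (mpow B j)"
proof -
  obtain Y where "mpow B i = mpow B j ** Y"
    using mpow_right_factor [OF assms(1)] .
  moreover obtain Z where "mpow B j = mpow B i ** Z"
    using mpow_right_factor [OF assms(2)] .
  ultimately show ?thesis
    by (rule mrange_eqI)
qed


section \<open>Orthogonal projectors and the Moore--Penrose inverse\<close>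

lemma ctranspose_mult: "ctranspose (B ** C) = ctranspose C ** ctranspose B"
  by (simp add: ctranspose_def matrix_matrix_mult_def vec_eq_iff mult.commute)

lemma ctranspose_ctranspose [simp]: "ctranspose (ctranspose B) = B"
  by (simp add: ctranspose_def vec_eq_iff)

lemma inner_vec_complex:
  "inner x y = Re (\<Sum>i\<in>UNIV. cnj (x $ i) * y $ i)" for x y :: "complex^'n"
  by (simp add: inner_vec_def inner_complex_def)

text \<open>
  The orthogonal decomposition used here is that of the real inner product. The range of a
  complex matrix is closed under multiplication by \<open>\<i>\<close>, so orthogonality to it in the real sense
  already gives orthogonality in the Hermitian sense.
\<close>

lemma normal_equation: "\<exists>u. ctranspose B *v (x - B *v u) = 0"
proof -
  have sp: "span (mrange B) = mrange B"
    unfolding mrange_def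
    by (intro span_eq_iff [THEN iffD2] linear_subspace_image subspace_UNIV matrix_vector_mul_linear)
  obtain y z where y: "y \<in> span (mrange B)"
    and z: "\<And>w. w \<in> span (mrange B) \<Longrightarrow> orthogonal z w" and x: "x = y + z"
    using orthogonal_subspace_decomp_exists [of "mrange B" x] by blast
  have orth: "inner (B *v v) z = 0" for v
    using z [of "B *v v"] sp unfolding orthogonal_def mrange_def by (metis inner_commute rangeI)
  have "(ctranspose B *v z) $ i = 0" for i
  proof -
    let ?c = "(ctranspose B *v z) $ i"
    have c: "inner (B *v axis i a) z = Re (cnj a * ?c)" for a
    proof -
      have "(B *v axis i a) $ j = a * B $ j $ i" for j
        by (simp add: mult_axis column_def)
      then show ?thesis
        by (simp add: inner_vec_complex ctranspose_def matrix_vector_mult_def sum_distrib_left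
            mult.assoc)
    qed
    \<comment> \<open>Testing against a unit vector and against \<open>\<i>\<close> times it recovers both parts of the entry.\<close>
    have "Re ?c = 0"
      using orth [of "axis i 1"] c [of 1] by simp
    moreover have "Im ?c = 0"
      using orth [of "axis i \<i>"] c [of \<i>] by simp
    ultimately show ?thesis
      by (simp add: complex_eq_iff)
  qed
  then have "ctranspose B *v z = 0"
    by (simp add: vec_eq_iff)
  moreover obtain u where "y = B *v u"
    using y sp by (metis imageE mrange_def)
  ultimately show ?thesis
    using x by (intro exI [of _ u]) simp
qed

text \<open>
  Solving the normal equations for all columns at once gives \<open>Y\<close> with \<open>B\<^sup>*BY = B\<^sup>*\<close>. Then \<open>BY\<close> satisfies
  \<open>(BY)\<^sup>*(BY) = (BY)\<^sup>*\<close>, which forces it to be Hermitian. So \<open>BY\<close> is the orthogonal projector onto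
  the range of \<open>B\<close>.
\<close>

lemma least_squares_inverse:
  obtains Y where "B ** Y ** B = B" "ctranspose (B ** Y) = B ** Y"
proof -
  have "ctranspose B *v x \<in> mrange (ctranspose B ** B)" for x
    using normal_equation [of B x]
    by (metis eq_iff_diff_eq_0 matrix_vector_mul_assoc matrix_vector_mult_diff_distrib mrange_def
        rangeI)
  then have "mrange (ctranspose B) \<subseteq> mrange (ctranspose B ** B)"
    by (auto simp: mrange_def [of "ctranspose B"])
  then obtain Y where Y: "ctranspose B = ctranspose B ** B ** Y"
    unfolding mrange_subset_iff_factor by blast
  let ?P = "B ** Y"
  have "ctranspose ?P ** ?P = ctranspose ?P"
    using Y by (metis ctranspose_mult matrix_mul_assoc)
  then have herm: "ctranspose ?P = ?P"
    by (metis ctranspose_ctranspose ctranspose_mult)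
  moreover have "?P ** B = B"
    using Y herm by (metis ctranspose_ctranspose ctranspose_mult matrix_mul_assoc)
  ultimately show ?thesis
    using that by blast
qed

lemma hermitian_idempotent_eqI:
  assumes "ctranspose P = P" "ctranspose Q = Q" "P ** Q = Q" "Q ** P = P"
  shows "P = Q"
proof -
  have "P = ctranspose (Q ** P)"
    using assms(1,4) by simp
  also have "\<dots> = P ** Q"
    using assms(1,2) by (simp only: ctranspose_mult)
  finally show ?thesis
    using assms(3) by simp
qed

lemma orth_proj_unique:
  assumes "P ** P = P" "ctranspose P = P" "mrange P = T"
  shows "orth_proj T = P"
  unfolding orth_proj_def
proof (rule the_equality)
  fix Q assume Q: "Q ** Q = Q \<and> ctranspose Q = Q \<and> mrange Q = T"
  have fix_range: "E ** F = F" if "E ** E = E" "mrange F \<subseteq> mrange E" for E F :: "complex^'a^'a"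
    using that by (metis matrix_mul_assoc mrange_subset_iff_factor)
  have "P ** Q = Q"
    using fix_range [OF assms(1), of Q] Q assms(3) by simp
  moreover have "Q ** P = P"
    using fix_range [of Q P] Q assms(3) by simp
  ultimately show "Q = P"
    using Q assms(2) by (metis hermitian_idempotent_eqI)
qed (use assms in simp)

lemma orth_proj_mrange:
  obtains Y where "orth_proj (mrange B) = B ** Y"
    and "orth_proj (mrange B) ** B = B"
    and "ctranspose (orth_proj (mrange B)) = orth_proj (mrange B)"
proof -
  obtain Y where Y: "B ** Y ** B = B" "ctranspose (B ** Y) = B ** Y"
    using least_squares_inverse .
  have "mrange (B ** Y) = mrange B"
    by (rule mrange_eqI [of _ _ Y B]) (simp_all add: Y)
  then have "orth_proj (mrange B) = B ** Y"
    using Y by (intro orth_proj_unique) (simp_all add: matrix_mul_assoc)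
  then show ?thesis
    using that Y by simp
qed

lemma moore_penrose_unique:
  assumes "B ** X ** B = B" "X ** B ** X = X"
    and "ctranspose (B ** X) = B ** X" "ctranspose (X ** B) = X ** B"
  shows "moore_penrose B = X"
  unfolding moore_penrose_def
proof (rule the_equality)
  fix X' assume X': "B ** X' ** B = B \<and> X' ** B ** X' = X'
     \<and> ctranspose (B ** X') = B ** X' \<and> ctranspose (X' ** B) = X' ** B"
  have "B ** X' = B ** X"
    by (rule hermitian_idempotent_eqI) (use assms X' in \<open>simp_all add: matrix_mul_assoc\<close>)
  moreover have "X' ** B = X ** B"
    by (metis (no_types, opaque_lifting) X' assms(1,4) ctranspose_mult matrix_mul_assoc)
  ultimately show "X' = X"
    using X' assms(2) by (metis matrix_mul_assoc)
qed (use assms in simp)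

text \<open>
  A least-squares inverse \<open>Y\<close> of \<open>B\<close> makes \<open>BY\<close> Hermitian, and the conjugate transpose \<open>Z\<close> of a
  least-squares inverse of \<open>B\<^sup>*\<close> makes \<open>ZB\<close> Hermitian. Then \<open>ZBY\<close> has all four Penrose properties.
\<close>

lemma moore_penrose_projector:
  shows "B ** moore_penrose B ** B = B"
    and "ctranspose (B ** moore_penrose B) = B ** moore_penrose B"
proof -
  obtain Y where Y: "B ** Y ** B = B" "ctranspose (B ** Y) = B ** Y"
    using least_squares_inverse .
  obtain Z' where Z': "ctranspose B ** Z' ** ctranspose B = ctranspose B"
      "ctranspose (ctranspose B ** Z') = ctranspose B ** Z'"
    using least_squares_inverse .
  define Z where "Z = ctranspose Z'"
  have Z: "B ** Z ** B = B" "ctranspose (Z ** B) = Z ** B"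
    using Z' unfolding Z_def by (metis ctranspose_ctranspose ctranspose_mult matrix_mul_assoc)+
  let ?X = "Z ** B ** Y"
  have X: "B ** ?X = B ** Y" "?X ** B = Z ** B"
    using Y(1) Z(1) by (metis matrix_mul_assoc)+
  have "moore_penrose B = ?X"
  proof (rule moore_penrose_unique)
    show "B ** ?X ** B = B" "ctranspose (B ** ?X) = B ** ?X" "ctranspose (?X ** B) = ?X ** B"
      using X Y Z by simp_all
    show "?X ** B ** ?X = ?X"
      unfolding X(2) using X(1) by (metis matrix_mul_assoc)
  qed
  then show "B ** moore_penrose B ** B = B"
    "ctranspose (B ** moore_penrose B) = B ** moore_penrose B"
    using X Y by simp_all
qed


section \<open>The weighted core-EP inverse\<close>

lemma swap_power_right: "C ** (mpow (D ** C) j ** E) = mpow (C ** D) j ** (C ** E)"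
  by (metis matrix_mul_assoc mpow_swap)

lemma Ind_le_wInd:
  assumes "wInd W C \<le> p"
  shows "Ind (C ** W) \<le> p" "Ind (W ** C) \<le> p"
  using assms by (simp_all add: wInd_def)

text \<open>
  Multiplying by \<open>C\<close> turns \<open>WCW\<close> into \<open>(CW)\<^sup>2\<close>, which the left factorization undoes on the stable
  range of \<open>CW\<close>. So \<open>WCW\<close> is injective there. This is the source of uniqueness, and later the way to
  prove an equation between matrices with columns in that range.
\<close>

lemma core_range_cancel:
  fixes W :: "complex^'q^'n" and C :: "complex^'n^'q" and U V :: "complex^'r^'q"
  assumes p: "wInd W C \<le> p"
    and U: "mrange U \<subseteq> mrange (mpow (C ** W) p)"
    and V: "mrange V \<subseteq> mrange (mpow (C ** W) p)"
    and eq: "W ** C ** W ** U = W ** C ** W ** V"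
  shows "U = V"
proof -
  obtain Z where Z: "mpow (C ** W) p = Z ** mpow (C ** W) (2 + p)"
    using mpow_left_factor [OF Ind_le_wInd(1) [OF p]] .
  have recover: "T = Z ** (C ** (W ** C ** W ** T))"
    if range: "mrange T \<subseteq> mrange (mpow (C ** W) p)" for T :: "complex^'r^'q"
  proof -
    obtain T' where T': "T = mpow (C ** W) p ** T'"
      using range mrange_subset_iff_factor by blast
    have "T = Z ** mpow (C ** W) (2 + p) ** T'"
      by (simp only: T' Z [symmetric])
    also have "\<dots> = Z ** (C ** (W ** C ** W ** T))"
      by (simp add: T' numeral_2_eq_2 mult_right_nested)
    finally show ?thesis .
  qed
  show ?thesis
    using recover [OF U] recover [OF V] eq by simp
qed

lemma weighted_core_EP_exists:
  assumes "wInd W C \<le> p"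
  obtains X where "W ** C ** W ** X = orth_proj (mrange (mpow (W ** C) p))"
    and "mrange X \<subseteq> mrange (mpow (C ** W) p)"
proof -
  obtain Y where Y: "mpow (W ** C) p = mpow (W ** C) (2 + p) ** Y"
    using mpow_right_factor [OF Ind_le_wInd(2) [OF assms]] .
  obtain V where V: "orth_proj (mrange (mpow (W ** C) p)) = mpow (W ** C) p ** V"
    using orth_proj_mrange .
  let ?X = "C ** (mpow (W ** C) p ** (Y ** V))"
  have "W ** C ** W ** ?X = mpow (W ** C) (2 + p) ** Y ** V"
    by (simp add: numeral_2_eq_2 mult_right_nested)
  then have "W ** C ** W ** ?X = orth_proj (mrange (mpow (W ** C) p))"
    by (simp only: V Y [symmetric])
  moreover have "mrange ?X \<subseteq> mrange (mpow (C ** W) p)"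
    unfolding mrange_subset_iff_factor swap_power_right by blast
  ultimately show ?thesis
    using that by blast
qed

lemma wcoreEP_exponent:
  assumes p: "wInd W C \<le> p"
  shows "mrange (mpow (W ** C) p) = mrange (mpow (W ** C) (wInd W C))"
    and "mrange (mpow (C ** W) p) = mrange (mpow (C ** W) (wInd W C))"
  by (rule mrange_mpow_eq; rule Ind_le_wInd p order_refl; rule p order_refl)+

text \<open>
  The characterization is stated for any exponent from the weighted index upwards, so that it
  applies when the index itself is not known.
\<close>

lemma wcoreEP_eqI:
  assumes "wInd W C \<le> p"
    and "W ** C ** W ** X = orth_proj (mrange (mpow (W ** C) p))"
    and "mrange X \<subseteq> mrange (mpow (C ** W) p)"
  shows "wcoreEP W C = X"
  unfolding wcoreEP_def
proof (rule the_equality)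
  fix X'
  assume X': "W ** C ** W ** X' = orth_proj (mrange (mpow (W ** C) (wInd W C)))
    \<and> mrange X' \<subseteq> mrange (mpow (C ** W) (wInd W C))"
  show "X' = X"
    by (rule core_range_cancel [OF order_refl [of "wInd W C"]])
      (use X' assms(2,3) in \<open>simp_all only: wcoreEP_exponent [OF assms(1)]\<close>)
next
  show "W ** C ** W ** X = orth_proj (mrange (mpow (W ** C) (wInd W C)))
    \<and> mrange X \<subseteq> mrange (mpow (C ** W) (wInd W C))"
    using assms(2,3) unfolding wcoreEP_exponent [OF assms(1)] by (rule conjI)
qed

lemma coreEP_eq_wcoreEP: "coreEP B = wcoreEP (mat 1) B"
  by (simp add: coreEP_def wcoreEP_def wInd_def)

locale weighted_matrix =
  fixes W :: "complex^'q^'n" and A :: "complex^'n^'q"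
begin

abbreviation "k \<equiv> wInd W A"
abbreviation "X \<equiv> wcoreEP W A"
abbreviation "P \<equiv> orth_proj (mrange (mpow (W ** A) k))"

lemma P_fixes_powers: "k \<le> j \<Longrightarrow> P ** mpow (W ** A) j = mpow (W ** A) j"
proof -
  assume j: "k \<le> j"
  obtain V where V: "mpow (W ** A) j = mpow (W ** A) k ** V"
    using mpow_right_factor [OF Ind_le_wInd(2) [OF j]] .
  show ?thesis
    unfolding V using orth_proj_mrange [of "mpow (W ** A) k"] by (metis matrix_mul_assoc)
qed

lemma P_hermitian: "ctranspose P = P"
  using orth_proj_mrange by metis

lemma X_eqs:
  shows WAWX: "W ** (A ** (W ** X)) = P"
    and X_range: "mrange X \<subseteq> mrange (mpow (A ** W) k)"
proof -
  obtain X' where X': "W ** A ** W ** X' = P" "mrange X' \<subseteq> mrange (mpow (A ** W) k)"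
    using weighted_core_EP_exists [OF order_refl, of W A] .
  then have "X = X'"
    by (intro wcoreEP_eqI [OF order_refl])
  with X' show "W ** (A ** (W ** X)) = P" "mrange X \<subseteq> mrange (mpow (A ** W) k)"
    by (simp_all add: mult_right_nested)
qed

lemmas WAWX_mult = mult_reassoc [OF WAWX, unfolded mult_right_nested]

lemma core_factor:
  obtains V where "X = mpow (A ** W) j ** V"
proof -
  obtain Y where "mpow (A ** W) k = mpow (A ** W) j ** Y"
    using mpow_right_factor [OF Ind_le_wInd(1) [OF order_refl]] .
  moreover obtain V where "X = mpow (A ** W) k ** V"
    using X_range mrange_subset_iff_factor by blast
  ultimately have "X = mpow (A ** W) j ** (Y ** V)"
    by (metis matrix_mul_assoc)
  then show ?thesis
    by (rule that)
qed

lemma core_range_mult: "mrange (X ** B) \<subseteq> mrange (mpow (A ** W) k)"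
proof -
  obtain V where "X = mpow (A ** W) k ** V"
    using core_factor .
  then have "X ** B = mpow (A ** W) k ** (V ** B)"
    by (metis matrix_mul_assoc)
  then show ?thesis
    using mrange_subset_iff_factor by blast
qed

text \<open>
  The columns of \<open>X\<close> lie in the range of \<open>(AW)\<^sup>k\<close>, which \<open>W\<close> maps into the range of \<open>(WA)\<^sup>k\<close>.
\<close>

lemma PWX: "P ** (W ** X) = W ** X"
proof -
  obtain V where "X = mpow (A ** W) k ** V"
    using core_factor .
  then have "W ** X = mpow (W ** A) k ** (W ** V)"
    by (simp add: swap_power_right)
  then show ?thesis
    using P_fixes_powers [OF order_refl] by (metis matrix_mul_assoc)
qed

text \<open>
  Both sides have columns in the range of \<open>(AW)\<^sup>k\<close>, so it suffices to compare them after
  multiplication by \<open>WAW\<close>, where \<open>WAWX = P\<close> and \<open>PWX = WX\<close> apply. The two absorption laws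
  \<open>XP\<close> and \<open>XWAW_power\<close> follow in the same way.
\<close>

lemma AWXWX: "A ** (W ** (X ** (W ** X))) = X"
proof (rule core_range_cancel [OF order_refl])
  obtain V where V: "X = mpow (A ** W) k ** V"
    using core_factor .
  have "A ** (W ** (X ** (W ** X))) = mpow (A ** W) k ** (A ** (W ** (V ** (W ** X))))"
    using mpow_Suc_right [of "A ** W" k] by (subst (1) V) (simp add: matrix_mul_assoc)
  then show "mrange (A ** (W ** (X ** (W ** X)))) \<subseteq> mrange (mpow (A ** W) k)"
    unfolding mrange_subset_iff_factor by blast
  show "W ** A ** W ** (A ** (W ** (X ** (W ** X)))) = W ** A ** W ** X"
    by (simp add: mult_right_nested WAWX WAWX_mult PWX)
qed (rule X_range)

lemma PP: "P ** P = P"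
proof -
  obtain V where "P = mpow (W ** A) k ** V"
    using orth_proj_mrange .
  then show ?thesis
    using P_fixes_powers [OF order_refl] by (metis matrix_mul_assoc)
qed

lemma XP: "X ** P = X"
proof (rule core_range_cancel [OF order_refl])
  show "W ** A ** W ** (X ** P) = W ** A ** W ** X"
    by (simp add: mult_right_nested WAWX WAWX_mult PP)
qed (rule core_range_mult, rule X_range)

lemma XWAW_power:
  assumes "k \<le> j"
  shows "X ** (W ** (A ** (W ** mpow (A ** W) j))) = mpow (A ** W) j"
proof (rule core_range_cancel [OF order_refl])
  have "W ** (A ** (W ** mpow (A ** W) j)) = mpow (W ** A) (Suc j) ** W"
    by (simp add: mpow_swap [of W A] mult_right_nested)
  moreover have "P ** (mpow (W ** A) (Suc j) ** W) = mpow (W ** A) (Suc j) ** W"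
    by (rule mult_reassoc) (use P_fixes_powers [of "Suc j"] assms in simp)
  ultimately show "W ** A ** W ** (X ** (W ** (A ** (W ** mpow (A ** W) j))))
      = W ** A ** W ** mpow (A ** W) j"
    by (simp add: mult_right_nested WAWX_mult)
  show "mrange (mpow (A ** W) j) \<subseteq> mrange (mpow (A ** W) k)"
    using wcoreEP_exponent(2) [OF assms] by simp
qed (rule core_range_mult)

lemmas AWXWX_mult = mult_reassoc [OF AWXWX, unfolded mult_right_nested]
lemmas PWX_mult = mult_reassoc [OF PWX, unfolded mult_right_nested]
lemmas XP_mult = mult_reassoc [OF XP, unfolded mult_right_nested]

lemma AW_power_X: "mpow (A ** W) j ** (X ** mpow (W ** X) j) = X"
proof (induction j)
  case (Suc j)
  then show ?case
    by (simp only: mpow_Suc_right [of "A ** W"] mpow.simps(2) [of "W ** X"] mult_right_nested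
        AWXWX_mult)
qed simp

lemma WA_power_WX: "mpow (W ** A) j ** (W ** (X ** mpow (W ** X) j)) = W ** X"
  by (simp only: AW_power_X flip: swap_power_right)

lemma XW_power_AW_power:
  assumes "k \<le> l"
  shows "mpow (X ** W) j ** (mpow (A ** W) j ** mpow (A ** W) l) = mpow (A ** W) l"
proof (induction j)
  case (Suc j)
  have "mpow (X ** W) (Suc j) ** (mpow (A ** W) (Suc j) ** mpow (A ** W) l)
      = mpow (X ** W) j ** (X ** (W ** (A ** (W ** mpow (A ** W) (j + l)))))"
    by (simp only: mpow_Suc_right [of "X ** W"] mpow.simps(2) [of "A ** W"] mpow_add mult_right_nested)
  also have "\<dots> = mpow (X ** W) j ** (mpow (A ** W) j ** mpow (A ** W) l)"
    using XWAW_power [of "j + l"] assms by (simp add: mpow_add)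
  finally show ?case
    using Suc by simp
qed simp

text \<open>
  On the stable range \<open>XW\<close> inverts \<open>AW\<close>, and the left-hand side is \<open>(XW)\<^sup>j\<^sup>+\<^sup>1(AW)\<^sup>j\<^sup>+\<^sup>1B\<close>.
\<close>

lemma X_power_cancel:
  assumes "mrange B \<subseteq> mrange (mpow (A ** W) k)"
  shows "X ** (mpow (W ** X) j ** (W ** (mpow (A ** W) (Suc j) ** B))) = B"
proof -
  obtain V where V: "B = mpow (A ** W) k ** V"
    using assms mrange_subset_iff_factor by blast
  have "X ** (mpow (W ** X) j ** (W ** (mpow (A ** W) (Suc j) ** B)))
      = mpow (X ** W) (Suc j) ** (mpow (A ** W) (Suc j) ** mpow (A ** W) k) ** V"
    by (simp only: V swap_power_right [of X] mpow_Suc_right [of "X ** W"] mult_right_nested)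
  then show ?thesis
    using XW_power_AW_power [OF order_refl, of "Suc j"] V by simp
qed

text \<open>
  The normal form of the weighted \<open>m\<close>-weak group inverse to which all representations are reduced.
\<close>

lemma wwgm_eq: "wwgm m W A = X ** (mpow (W ** X) m ** mpow (W ** A) m)"
  by (simp add: wwgm_def wpow_Suc W_wpow_eq swap_power_right mult_right_nested)

end


section \<open>The weighted Drazin inverse\<close>

lemma mpow_commute: "B ** U = U ** B \<Longrightarrow> mpow B j ** U = U ** mpow B j"
  by (induction j) (simp_all, metis matrix_mul_assoc)

text \<open>
  Commutation and \<open>TBT = T\<close> give \<open>T = T\<^sup>pB\<^sup>pT\<close> for both candidates. Inserting the power
  equation of \<open>V\<close> into this formula for \<open>U\<close>, and the one of \<open>U\<close> into the formula for \<open>V\<close>,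
  shows that both are equal to \<open>UBV\<close>.
\<close>

lemma drazin_unique:
  assumes U: "mpow B p = mpow B (Suc p) ** U" "U = U ** B ** U" "B ** U = U ** B"
    and V: "mpow B p = mpow B (Suc p) ** V" "V = V ** B ** V" "B ** V = V ** B"
  shows "U = V"
proof -
  have inner_power: "mpow T j ** (mpow B j ** T) = T"
    if T: "T = T ** B ** T" "B ** T = T ** B" for T j
  proof (induction j)
    case (Suc j)
    have "mpow T (Suc j) ** (mpow B (Suc j) ** T) = mpow T j ** (T ** B ** T ** mpow B j)"
      by (simp only: mpow_Suc_right [of T] mpow.simps(2) [of B] mult_right_nested
          mpow_commute [OF T(2)])
    also have "\<dots> = mpow T j ** (mpow B j ** T)"
      by (simp only: T(1) [symmetric] mpow_commute [OF T(2)])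
    finally show ?case
      using Suc by simp
  qed simp
  have "U = mpow U p ** (U ** mpow B p)"
    using inner_power [OF U(2,3), of p] by (simp add: mpow_commute [OF U(3)])
  also have "\<dots> = mpow U p ** (mpow B p ** U) ** (B ** V)"
    by (subst V(1)) (simp only: mpow_Suc_right mult_right_nested mpow_commute [OF U(3)])
  also have "\<dots> = U ** (B ** V)"
    using inner_power [OF U(2,3)] by simp
  finally have 1: "U = U ** (B ** V)" .
  have comm: "mpow V p ** mpow B p = mpow B p ** mpow V p"
    by (metis V(3) mpow_commute)
  have "V = mpow B p ** (mpow V p ** V)"
    using inner_power [OF V(2,3), of p] comm by (metis matrix_mul_assoc)
  also have "\<dots> = mpow B (Suc p) ** U ** (mpow V p ** V)"
    using U(1) by simp
  also have "\<dots> = U ** mpow B (Suc p) ** (mpow V p ** V)"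
    by (simp only: mpow_commute [OF U(3)])
  also have "\<dots> = U ** (B ** (mpow B p ** (mpow V p ** V)))"
    by (simp only: mpow.simps(2) mult_right_nested)
  also have "\<dots> = U ** (B ** V)"
    using inner_power [OF V(2,3), of p] comm by (metis matrix_mul_assoc)
  finally show ?thesis
    using 1 by simp
qed

text \<open>
  The power equation at one exponent implies it at the weighted index, by the left factorization of
  \<open>(CW)\<^sup>i\<close>. For uniqueness, \<open>XW\<close> is a Drazin inverse of \<open>CW\<close>, hence unique, and
  \<open>X = (XW)(XW)C\<close> recovers \<open>X\<close> from it.
\<close>

lemma wDrazin_eqI:
  assumes power: "mpow (C ** W) p = mpow (C ** W) (Suc p) ** X ** W"
    and inner: "X = X ** W ** C ** W ** X"
    and comm: "C ** W ** X = X ** W ** C"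
  shows "wDrazin W C = X"
  unfolding wDrazin_def
proof (rule the_equality)
  let ?i = "wInd W C"
  obtain Z where Z: "mpow (C ** W) ?i = Z ** mpow (C ** W) p"
    using mpow_left_factor [OF Ind_le_wInd(1) [OF order_refl]] .
  have "mpow (C ** W) (Suc ?i) = Z ** mpow (C ** W) (Suc p)"
    unfolding mpow_Suc_right Z by (simp only: mult_right_nested)
  then have "mpow (C ** W) ?i = mpow (C ** W) (?i + 1) ** X ** W"
    using Z power by (metis Suc_eq_plus1 matrix_mul_assoc)
  then show *: "mpow (C ** W) ?i = mpow (C ** W) (?i + 1) ** X ** W
    \<and> X = X ** W ** C ** W ** X \<and> C ** W ** X = X ** W ** C"
    using inner comm by blast
  fix X'
  assume X': "mpow (C ** W) ?i = mpow (C ** W) (?i + 1) ** X' ** W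
    \<and> X' = X' ** W ** C ** W ** X' \<and> C ** W ** X' = X' ** W ** C"
  have recover: "T = (T ** W) ** (T ** W) ** C"
    if "T = T ** W ** C ** W ** T" "C ** W ** T = T ** W ** C" for T
    using that by (metis matrix_mul_assoc)
  have "X' ** W = X ** W"
  proof (rule drazin_unique)
    show "mpow (C ** W) ?i = mpow (C ** W) (Suc ?i) ** (X' ** W)"
      "mpow (C ** W) ?i = mpow (C ** W) (Suc ?i) ** (X ** W)"
      using X' * unfolding Suc_eq_plus1 matrix_mul_assoc by blast+
    show "X' ** W = X' ** W ** (C ** W) ** (X' ** W)" "X ** W = X ** W ** (C ** W) ** (X ** W)"
      using X' * unfolding matrix_mul_assoc by metis+
    show "C ** W ** (X' ** W) = X' ** W ** (C ** W)" "C ** W ** (X ** W) = X ** W ** (C ** W)"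
      using X' * unfolding matrix_mul_assoc by metis+
  qed
  then show "X' = X"
    using recover [of X'] recover [of X] X' inner comm by metis
qed

lemma Ind_le_1:
  assumes "B = Z ** (B ** B)"
  shows "Ind B \<le> 1"
  unfolding Ind_def
proof (rule Least_le)
  have "rank B \<le> rank (B ** B)"
    using assms rank_mult_le_right_factor [of Z "B ** B"] by simp
  then show "rank (mpow B 1) = rank (mpow B (Suc 1))"
    using rank_mult_le_right_factor [of B B] by simp
qed

text \<open>
  The assumptions give \<open>C = XWCWC\<close>, so both \<open>CW\<close> and \<open>WC\<close> are left multiples of their squares.
\<close>

lemma wInd_le_1:
  assumes "C ** W ** C ** W ** X = C" "C ** W ** X = X ** W ** C"
  shows "wInd W C \<le> 1"
proof -
  have C: "C = X ** W ** C ** W ** C"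
    using assms by (metis matrix_mul_assoc)
  have "Ind (C ** W) \<le> 1"
    by (rule Ind_le_1 [of _ "X ** W"]) (use C in \<open>metis matrix_mul_assoc\<close>)
  moreover have "Ind (W ** C) \<le> 1"
    by (rule Ind_le_1 [of _ "W ** X"]) (use C in \<open>metis matrix_mul_assoc\<close>)
  ultimately show ?thesis
    by (simp add: wInd_def)
qed

context weighted_matrix
begin

lemma WXWA_power: "W ** (X ** mpow (W ** A) (Suc (Suc k))) = mpow (W ** A) (Suc k)"
proof -
  have "mpow (W ** A) (Suc j) = W ** (mpow (A ** W) j ** A)" for j
    by (simp add: mult_right_nested flip: mpow_swap)
  then show ?thesis
    using mult_reassoc [OF XWAW_power [OF order_refl], of A] by (simp add: mult_right_nested)
qed

text \<open>
  The Drazin inverse is the weighted weak group inverse with a large parameter, here \<open>k + 1\<close>: the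
  factor \<open>(WA)\<^sup>k\<^sup>+\<^sup>1\<close> has its columns in the stable range, where \<open>WX\<close> inverts \<open>WA\<close>. The parameter
  \<open>k + 1\<close> instead of \<open>k\<close> lets one write \<open>(WA)\<^sup>k\<^sup>+\<^sup>1 = W(AW)\<^sup>kA\<close> with the stable power inside.
\<close>

lemma wDrazin_eqs:
  shows wDrazin_power: "mpow (A ** W) (Suc k) = mpow (A ** W) (Suc (Suc k)) ** wDrazin W A ** W"
    and wDrazin_comm: "A ** W ** wDrazin W A = wDrazin W A ** W ** A"
proof -
  let ?Y = "X ** (mpow (W ** X) (Suc k) ** mpow (W ** A) (Suc k))"
  have AWY: "A ** (W ** ?Y) = X ** (mpow (W ** X) k ** mpow (W ** A) (Suc k))"
    by (simp only: mpow.simps(2) [of "W ** X"] mult_right_nested AWXWX_mult)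
  have "?Y ** W ** A = X ** (mpow (W ** X) k ** (W ** (X ** mpow (W ** A) (Suc (Suc k)))))"
    by (simp only: mpow_Suc_right mult_right_nested)
  also have "\<dots> = X ** (mpow (W ** X) k ** mpow (W ** A) (Suc k))"
    by (simp only: WXWA_power)
  finally have YWA: "?Y ** W ** A = X ** (mpow (W ** X) k ** mpow (W ** A) (Suc k))" .
  have comm: "A ** W ** ?Y = ?Y ** W ** A"
    unfolding YWA AWY [symmetric] by (simp only: mult_right_nested)
  have "?Y ** W ** A ** W ** ?Y
      = X ** (mpow (W ** X) k ** (mpow (W ** A) (Suc k) ** (W ** ?Y)))"
    unfolding YWA by (simp only: mult_right_nested)
  also have "\<dots> = X ** (mpow (W ** X) k ** (W ** (X ** mpow (W ** A) (Suc k))))"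
    using mult_reassoc [OF WA_power_WX [of "Suc k"], of "mpow (W ** A) (Suc k)"]
    by (simp only: mult_right_nested)
  also have "\<dots> = ?Y"
    by (simp only: mpow_Suc_right [of "W ** X"] mult_right_nested)
  finally have inner: "?Y = ?Y ** W ** A ** W ** ?Y" ..
  have "mpow (A ** W) (Suc (Suc k)) ** ?Y ** W
      = A ** (W ** (X ** (mpow (W ** A) (Suc k) ** W)))"
    using mult_reassoc [OF AW_power_X [of "Suc k"], of "mpow (W ** A) (Suc k) ** W"]
    by (simp only: mpow.simps(2) [of _ "Suc k"] mult_right_nested)
  also have "\<dots> = A ** (W ** (X ** (W ** (A ** (W ** mpow (A ** W) k)))))"
    by (simp only: mpow_swap [of W A, symmetric] mpow.simps(2) mult_right_nested)
  also have "\<dots> = mpow (A ** W) (Suc k)"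
    by (simp add: XWAW_power mult_right_nested)
  finally have power: "mpow (A ** W) (Suc k) = mpow (A ** W) (Suc (Suc k)) ** ?Y ** W" ..
  have "wDrazin W A = ?Y"
    by (rule wDrazin_eqI [OF power inner comm])
  with power comm show "mpow (A ** W) (Suc k) = mpow (A ** W) (Suc (Suc k)) ** wDrazin W A ** W"
    "A ** W ** wDrazin W A = wDrazin W A ** W ** A"
    by (simp_all only:)
qed


section \<open>Representations of the weighted weak group inverse\<close>

text \<open>
  Commutation moves the Drazin inverse past \<open>AW\<close> to the position of the power equation, so
  its product with \<open>WAW\<close> fixes the range of \<open>(AW)\<^sup>k\<^sup>+\<^sup>1\<close>. That range contains the columns of \<open>X\<close>.
\<close>

lemma wDrazin_cancels: "wDrazin W A ** (W ** (A ** (W ** X))) = X"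
proof -
  obtain V where V: "X = mpow (A ** W) (Suc k) ** V"
    using core_factor .
  have "mpow (A ** W) (Suc (Suc k)) ** (wDrazin W A ** W)
      = wDrazin W A ** W ** mpow (A ** W) (Suc (Suc k))"
    by (rule mpow_commute) (simp only: matrix_mul_assoc wDrazin_comm)
  then have "wDrazin W A ** W ** mpow (A ** W) (Suc (Suc k)) = mpow (A ** W) (Suc k)"
    by (metis matrix_mul_assoc wDrazin_power)
  then have "wDrazin W A ** (W ** (A ** (W ** mpow (A ** W) (Suc k)))) = mpow (A ** W) (Suc k)"
    by (simp only: mpow.simps(2) [of _ "Suc k"] mult_right_nested)
  from mult_reassoc [OF this, of V] show ?thesis
    by (simp only: mult_right_nested flip: V)
qed

lemma wDrazin_X_power:
  "mpow (wDrazin W A ** W) j ** X = X ** mpow (W ** X) j"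
proof (induction j)
  case (Suc j)
  have "mpow (wDrazin W A ** W) (Suc j) ** X
      = wDrazin W A ** (W ** (X ** mpow (W ** X) j))"
    using Suc by (simp add: mult_right_nested)
  also have "\<dots> = wDrazin W A ** (W ** (A ** (W ** (X ** (W ** X))))) ** mpow (W ** X) j"
    by (simp only: AWXWX mult_right_nested)
  also have "\<dots> = X ** mpow (W ** X) (Suc j)"
    using mult_reassoc [OF wDrazin_cancels]
    by (simp add: mult_right_nested)
  finally show ?case .
qed simp

lemma wwgm_eq_wDrazin:
  "wwgm m W A = wpow W (wDrazin W A) (m + 1) ** P ** W_wpow W A m"
proof -
  have "wDrazin W A ** P = X"
    using wDrazin_cancels by (simp only: WAWX)
  then have "wpow W (wDrazin W A) (m + 1) ** P = X ** mpow (W ** X) m"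
    by (simp add: wpow_Suc wDrazin_X_power mult_right_nested)
  then show ?thesis
    by (simp add: wwgm_eq W_wpow_eq mult_right_nested)
qed

text \<open>
  The matrix \<open>B = W(AW)\<^sup>l\<^sup>+\<^sup>m\<^sup>+\<^sup>1\<close> has the same range as \<open>(WA)\<^sup>k\<close>, so \<open>P\<close> is the product of \<open>B\<close> and its
  Moore-Penrose inverse. Since \<open>XP = X\<close>, this product can be inserted behind \<open>(XW)\<^sup>mX\<close>, and then
  \<open>X(WX)\<^sup>mW\<close> cancels the factor \<open>(AW)\<^sup>m\<^sup>+\<^sup>1\<close> of \<open>B\<close> on the stable range.
\<close>

lemma wwgm_eq_moore_penrose:
  assumes l: "k \<le> l"
  shows "wwgm m W A
    = wpow_W W A l ** moore_penrose (W ** wpow W A (l + m + 1) ** W) ** W_wpow W A m"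
proof -
  let ?B = "W ** wpow W A (l + m + 1) ** W" and ?j = "Suc (l + m)"
  have B: "?B = W ** mpow (A ** W) ?j"
    by (simp only: Suc_eq_plus1 [symmetric] wpow_Suc mpow_Suc_right mult_right_nested)
  have B': "?B = mpow (W ** A) ?j ** W"
    unfolding B by (rule mpow_swap)
  have "mrange ?B = mrange (mpow (W ** A) k)"
  proof -
    obtain Y where Y: "mpow (W ** A) ?j = mpow (W ** A) k ** Y"
      using mpow_right_factor [of "W ** A" ?j k] Ind_le_wInd(2) [of W A ?j] l by auto
    obtain Y' where Y': "mpow (W ** A) k = mpow (W ** A) (Suc ?j) ** Y'"
      using mpow_right_factor [OF Ind_le_wInd(2) [OF order_refl]] .
    show ?thesis
    proof (rule mrange_eqI)
      show "?B = mpow (W ** A) k ** (Y ** W)"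
        unfolding B' Y by (simp only: mult_right_nested)
      show "mpow (W ** A) k = ?B ** (A ** Y')"
        unfolding B' by (subst Y') (simp only: mpow_Suc_right [of _ ?j] mult_right_nested)
    qed
  qed
  moreover have "mrange (?B ** moore_penrose ?B) = mrange ?B"
    by (rule mrange_eqI [OF refl, of _ _ ?B]) (simp only: moore_penrose_projector(1))
  ultimately have BB: "?B ** moore_penrose ?B = P"
    using moore_penrose_projector [of ?B]
    by (intro orth_proj_unique [symmetric]) (simp_all add: matrix_mul_assoc)
  have "X ** mpow (W ** X) m = mpow (X ** W) m ** (X ** (?B ** moore_penrose ?B))"
    by (simp only: BB XP mpow_swap)
  also have "\<dots> = X ** (mpow (W ** X) m ** (W ** (mpow (A ** W) (Suc m)
      ** (mpow (A ** W) l ** moore_penrose ?B))))"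
  proof -
    have "?j = Suc m + l"
      by simp
    then show ?thesis
      unfolding B swap_power_right [of X] by (simp only: mpow_add mult_right_nested)
  qed
  also have "\<dots> = mpow (A ** W) l ** moore_penrose ?B"
  proof (rule X_power_cancel)
    show "mrange (mpow (A ** W) l ** moore_penrose ?B) \<subseteq> mrange (mpow (A ** W) k)"
      using wcoreEP_exponent(2) [OF l] mrange_subset_iff_factor by blast
  qed
  finally show ?thesis
    by (simp add: wwgm_eq wpow_W_eq W_wpow_eq matrix_mul_assoc)
qed

text \<open>
  Here the Moore-Penrose inverse is explicit: \<open>H\<close> and \<open>F = X(WX)\<^sup>m\<close> are inverse to each other between the
  two stable ranges, so \<open>HF\<close> and \<open>FH\<close> are the orthogonal projectors onto them.
\<close>

lemma wwgm_eq_moore_penrose_projector: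
  "wwgm m W A
    = moore_penrose (W ** wpow W A (m + 1) ** W ** orth_proj (mrange (mpow (A ** W) k)))
        ** W_wpow W A m"
proof -
  let ?S = "orth_proj (mrange (mpow (A ** W) k))"
  let ?H = "W ** wpow W A (m + 1) ** W ** ?S" and ?F = "X ** mpow (W ** X) m"
  obtain V where V: "?S = mpow (A ** W) k ** V"
    and S: "?S ** mpow (A ** W) k = mpow (A ** W) k" "ctranspose ?S = ?S"
    using orth_proj_mrange .
  have S_absorb: "?S ** B = B" if range: "mrange B \<subseteq> mrange (mpow (A ** W) k)" for B :: "complex^'x^'q"
  proof -
    obtain Y where "B = mpow (A ** W) k ** Y"
      using range mrange_subset_iff_factor by blast
    then show ?thesis
      using S(1) by (metis matrix_mul_assoc)
  qed
  have S_range: "mrange ?S \<subseteq> mrange (mpow (A ** W) k)"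
    using V mrange_subset_iff_factor by blast
  have H: "?H = W ** (mpow (A ** W) (Suc m) ** ?S)"
    by (simp only: Suc_eq_plus1 [symmetric] wpow_Suc mpow_Suc_right mult_right_nested)
  have "?H ** ?F = W ** (mpow (A ** W) (Suc m) ** ?F)"
    unfolding H by (simp only: mult_right_nested S_absorb [OF core_range_mult])
  also have "\<dots> = P"
    by (simp only: mpow.simps(2) mult_right_nested AW_power_X WAWX)
  finally have HF: "?H ** ?F = P" .
  have FH: "?F ** ?H = ?S"
    unfolding H using X_power_cancel [OF S_range] by (simp only: mult_right_nested)
  have "moore_penrose ?H = ?F"
  proof (rule moore_penrose_unique)
    show "?H ** ?F ** ?H = ?H"
      using FH S_absorb [OF S_range] by (simp only: mult_right_nested)
    show "?F ** ?H ** ?F = ?F"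
      unfolding FH by (rule S_absorb [OF core_range_mult])
    show "ctranspose (?H ** ?F) = ?H ** ?F" "ctranspose (?F ** ?H) = ?F ** ?H"
      unfolding HF FH by (rule P_hermitian S(2))+
  qed
  then show ?thesis
    by (simp add: wwgm_eq W_wpow_eq matrix_mul_assoc)
qed

text \<open>
  The two defining equations force \<open>G = (AWG)WG = XW(AWG) = XWXWA\<close>.
\<close>

lemma wwg_eq: "wwg W A = X ** (W ** (X ** (W ** A)))"
  unfolding wwg_def
proof (rule the_equality)
  let ?G = "X ** (W ** (X ** (W ** A)))"
  have "A ** (W ** ?G) = X ** (W ** A)"
    by (simp only: AWXWX_mult)
  moreover have "X ** (W ** A) ** (W ** ?G) = ?G"
    by (simp only: mult_right_nested WAWX_mult PWX_mult)
  ultimately show "A ** W ** wpow W ?G 2 = ?G \<and> A ** W ** ?G = X ** W ** A"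
    by (simp add: numeral_2_eq_2 wprod_def) (simp add: mult_right_nested WAWX_mult PWX_mult AWXWX_mult)
  fix G assume "A ** W ** wpow W G 2 = G \<and> A ** W ** G = X ** W ** A"
  then have G: "A ** W ** (G ** W ** G) = G" "A ** W ** G = X ** W ** A"
    by (simp_all add: numeral_2_eq_2 wprod_def)
  then have "G = X ** W ** A ** W ** G"
    by (metis matrix_mul_assoc)
  then show "G = ?G"
    using G(2) by (metis matrix_mul_assoc)
qed

lemma wpow_wwg: "wpow W (wwg W A) (Suc j) = X ** (mpow (W ** X) (Suc j) ** (W ** A))"
  unfolding wpow_Suc
proof (induction j)
  case (Suc j)
  have "mpow (wwg W A ** W) (Suc j) ** wwg W A
      = wwg W A ** (W ** (X ** (mpow (W ** X) (Suc j) ** (W ** A))))"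
    using Suc by (simp only: mpow.simps(2) [of "wwg W A ** W"] mult_right_nested)
  also have "\<dots> = X ** (mpow (W ** X) (Suc (Suc j)) ** (W ** A))"
    by (simp add: wwg_eq mult_right_nested WAWX_mult PWX_mult)
  finally show ?case .
qed (simp add: wwg_eq mult_right_nested)

text \<open>
  The stable ranges of the powers of \<open>AW\<close> and \<open>WA\<close> are those of \<open>AW\<close> and \<open>WA\<close> themselves. The index of a power
  may be smaller than \<open>k\<close>, so the exponent \<open>p\<close> is taken above both indices.
\<close>

lemma wcoreEP_wpow: "wcoreEP W (wpow W A (Suc j)) = X ** mpow (W ** X) j"
proof -
  let ?C = "wpow W A (Suc j)"
  define p where "p = max k (wInd W ?C)"
  have C: "?C ** W = mpow (A ** W) (Suc j)" "W ** ?C = mpow (W ** A) (Suc j)"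
    using wpow_W_eq [of W A "Suc j"] W_wpow_eq [of W A "Suc j"]
    by (simp_all add: wpow_W_def W_wpow_def)
  have "p \<le> Suc j * p"
    by simp
  then have jp: "k \<le> Suc j * p"
    unfolding p_def by linarith
  show ?thesis
  proof (rule wcoreEP_eqI)
    show "wInd W ?C \<le> p"
      by (simp add: p_def)
    have "W ** ?C ** W ** (X ** mpow (W ** X) j) = W ** (A ** (W ** X))"
      by (simp only: C mult_right_nested mpow.simps(2) [of "W ** A"] WA_power_WX)
    then show "W ** ?C ** W ** (X ** mpow (W ** X) j) = orth_proj (mrange (mpow (W ** ?C) p))"
      by (simp only: C WAWX mpow_mpow wcoreEP_exponent [OF jp])
    show "mrange (X ** mpow (W ** X) j) \<subseteq> mrange (mpow (?C ** W) p)"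
      by (simp only: C mpow_mpow wcoreEP_exponent [OF jp] core_range_mult)
  qed
qed

lemma wwgm_eq_wwg_wpow:
  "wwgm (Suc j) W A = wpow_W W A j ** wwg W (wpow W A (Suc j))"
proof -
  have "W ** wpow W A (Suc j) = mpow (W ** A) (Suc j)"
    using W_wpow_eq [of W A "Suc j"] by (simp add: W_wpow_def)
  then have "wwg W (wpow W A (Suc j)) = X ** (mpow (W ** X) j ** (W ** (X ** (mpow (W ** X) j
      ** mpow (W ** A) (Suc j)))))"
    unfolding weighted_matrix.wwg_eq wcoreEP_wpow by (simp only: mult_right_nested)
  then have "wpow_W W A j ** wwg W (wpow W A (Suc j))
      = X ** (W ** (X ** (mpow (W ** X) j ** mpow (W ** A) (Suc j))))"
    using mult_reassoc [OF AW_power_X [of j]] by (simp only: wpow_W_eq mult_right_nested)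
  then show ?thesis
    by (simp only: wwgm_eq mpow.simps(2) [of "W ** X"] mult_right_nested)
qed

lemma wwgm_eq_wpow_wwg:
  "wwgm (Suc j) W A = wpow W (wwg W A) (Suc j) ** W_wpow W A j"
  by (simp only: wwgm_eq wpow_wwg W_wpow_eq mpow.simps(2) [of "W ** A"] mult_right_nested)

text \<open>
  With \<open>D = (AW)\<^sup>mXWA\<close> and \<open>E = X(WX)\<^sup>mWA\<close>, both \<open>DWE\<close> and \<open>EWD\<close> reduce to \<open>XWA\<close>, which acts as an
  identity for \<open>D\<close> on the right and for \<open>E\<close> on the left. So \<open>E\<close> is a weighted group inverse.
\<close>

lemma wgroup_eq:
  shows "wInd W (mpow (A ** W) m ** X ** W ** A) \<le> 1"
    and "wgroup W (mpow (A ** W) m ** X ** W ** A) = X ** (mpow (W ** X) m ** (W ** A))"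
proof -
  define D where "D = mpow (A ** W) m ** X ** W ** A"
  let ?E = "X ** (mpow (W ** X) m ** (W ** A))"
  have D: "D = mpow (A ** W) m ** (X ** (W ** A))"
    by (simp only: D_def mult_right_nested)
  have DWE: "D ** (W ** ?E) = X ** (W ** A)"
    using mult_reassoc [OF AW_power_X [of m], of "W ** A"]
    by (simp only: D mult_right_nested WAWX_mult XP_mult)
  have EWD: "?E ** (W ** D) = X ** (W ** A)"
    using X_power_cancel [OF core_range_mult, of m "W ** A"]
    by (simp only: D mult_right_nested mpow.simps(2) [of "A ** W"])
  have comm: "D ** W ** ?E = ?E ** W ** D"
    using DWE EWD by (simp only: mult_right_nested)
  have DWDWE: "D ** W ** D ** W ** ?E = D"
    using DWE by (simp only: mult_right_nested) (simp only: D mult_right_nested WAWX_mult XP_mult)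
  show "wInd W (mpow (A ** W) m ** X ** W ** A) \<le> 1"
    unfolding D_def [symmetric] by (rule wInd_le_1 [OF DWDWE comm])
  show "wgroup W (mpow (A ** W) m ** X ** W ** A) = ?E"
    unfolding D_def [symmetric] wgroup_def
  proof (rule wDrazin_eqI [where p = 1])
    show "mpow (D ** W) 1 = mpow (D ** W) (Suc 1) ** ?E ** W"
      using DWDWE by (simp add: matrix_mul_assoc)
    show "?E = ?E ** W ** D ** W ** ?E"
      using mult_reassoc [OF EWD, of "W ** ?E"]
      by (simp only: mult_right_nested WAWX_mult XP_mult)
    show "D ** W ** ?E = ?E ** W ** D"
      by (rule comm)
  qed
qed

lemma wwgm_eq_wgroup:
  "wwgm (Suc j) W A = wgroup W (mpow (A ** W) (Suc j) ** X ** W ** A) ** W_wpow W A j"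
  unfolding wgroup_eq by (simp only: wwgm_eq W_wpow_eq mpow.simps(2) [of "W ** A"] mult_right_nested)

text \<open>
  The product \<open>(WA)(WX)\<close> is \<open>P\<close> by definition of \<open>X\<close>, and the columns of \<open>WX\<close> lie in the stable range of \<open>WA\<close>.
\<close>

lemma coreEP_eq: "coreEP (W ** A) = W ** X"
  unfolding coreEP_eq_wcoreEP
proof (rule wcoreEP_eqI [of _ _ k])
  show "wInd (mat 1) (W ** A) \<le> k"
    by (simp add: wInd_def)
  show "mat 1 ** (W ** A) ** mat 1 ** (W ** X) = orth_proj (mrange (mpow (mat 1 ** (W ** A)) k))"
    by (simp add: mult_right_nested WAWX)
  obtain V where "X = mpow (A ** W) k ** V"
    using core_factor .
  then have "W ** X = mpow (W ** A) k ** (W ** V)"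
    by (simp add: swap_power_right)
  then show "mrange (W ** X) \<subseteq> mrange (mpow (W ** A ** mat 1) k)"
    unfolding mrange_subset_iff_factor by auto
qed

text \<open>
  Between the two factors of the square, \<open>(WA)\<^sup>m\<close> cancels \<open>(WX)\<^sup>m\<close>; what remains is \<open>AWXWX = X\<close>
  in front of \<open>(WX)\<^sup>m(WA)\<^sup>m\<close>.
\<close>

lemma wwgm_eq_wgm: "wwgm m W A = A ** mpow (wgm m (W ** A)) 2"
proof -
  let ?R = "W ** X"
  have "A ** mpow (wgm m (W ** A)) 2
     = A ** (mpow ?R (Suc m) ** (mpow (W ** A) m ** (W ** (X ** mpow ?R m))) ** mpow (W ** A) m)"
    by (simp add: wgm_def coreEP_eq numeral_2_eq_2 mult_right_nested)
  also have "\<dots> = A ** (mpow ?R (Suc (Suc m)) ** mpow (W ** A) m)"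
    by (simp only: WA_power_WX mpow_Suc_right [of ?R "Suc m"])
  also have "\<dots> = X ** (mpow ?R m ** mpow (W ** A) m)"
    by (simp only: mpow.simps(2) [of ?R] mult_right_nested AWXWX_mult)
  finally show ?thesis
    by (simp only: wwgm_eq)
qed

end

theorem theorem3p4:
  fixes A :: "complex^'n^'q" and W :: "complex^'q^'n" and m k :: nat
  assumes W: "W \<noteq> 0"
    and m: "m > 0"
    and k: "k = max (Ind (A ** W)) (Ind (W ** A))"
  shows
    "(wwgm m W A
        = wpow W (wDrazin W A) (m + 1) ** orth_proj (mrange (mpow (W ** A) k)) ** W_wpow W A m)
   \<and> (\<forall>l\<ge>k. wwgm m W A
        = wpow_W W A l ** moore_penrose (W ** wpow W A (l + m + 1) ** W) ** W_wpow W A m)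
   \<and> (wwgm m W A
        = moore_penrose (W ** wpow W A (m + 1) ** W ** orth_proj (mrange (mpow (A ** W) k)))
            ** W_wpow W A m)
   \<and> (wwgm m W A = wpow_W W A (m - 1) ** wwg W (wpow W A m))
   \<and> (wwgm m W A = wpow W (wwg W A) m ** W_wpow W A (m - 1))
   \<and> (wInd W (mpow (A ** W) m ** wcoreEP W A ** W ** A) \<le> 1
      \<and> wwgm m W A
        = wgroup W (mpow (A ** W) m ** wcoreEP W A ** W ** A) ** W_wpow W A (m - 1))
   \<and> (wwgm m W A = A ** mpow (wgm m (W ** A)) 2)"
proof -
  interpret weighted_matrix W A .
  obtain j where j: "m = Suc j"
    using m gr0_implies_Suc by blast
  have k: "k = wInd W A"
    using k by (simp add: wInd_def)
  show ?thesis
    unfolding k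
  proof (intro conjI allI impI)
    show "wwgm m W A = wpow_W W A (m - 1) ** wwg W (wpow W A m)"
      "wwgm m W A = wpow W (wwg W A) m ** W_wpow W A (m - 1)"
      "wwgm m W A
        = wgroup W (mpow (A ** W) m ** wcoreEP W A ** W ** A) ** W_wpow W A (m - 1)"
      unfolding j diff_Suc_1 by (rule wwgm_eq_wwg_wpow wwgm_eq_wpow_wwg wwgm_eq_wgroup)+
  qed (rule wwgm_eq_wDrazin wwgm_eq_moore_penrose wwgm_eq_moore_penrose_projector wgroup_eq
      wwgm_eq_wgm, assumption?)+
qed

end
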